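(* Let $d\ge 1$ be an integer, let $L\ge 0$, let $f:\mathbb{R}^d\to\mathbb{R}$ be convex and globally $L$-Lipschitz, and let $\mathcal{X}\subseteq\mathbb{R}^d$ be nonempty, closed and convex. Assume that $\mathcal{X}_\star:=\operatorname*{argmin}_{x\in\mathcal{X}}f(x)$ is nonempty and put $f_\star:=\min_{x\in\mathcal{X}}f(x)$. Let $n\ge1$ be an integer, $\eta>0$, and $x_1\in\mathcal{X}$. Let $(x_k)_{k=1}^n$ be any sequence generated by $$x_{k+1}=\Pi_{\mathcal{X}}(x_k-\eta g_k),\qquad 1\le k<n,$$ using arbitrary choices $g_k\in\partial f(x_k)$ for every $1\le k<n$. Then $$f(x_n)-f_\star\le\left(2d+\frac12\right)\eta L^2+\frac{\operatorname{dist}(x_1,\mathcal{X}_\star)^2}{2n\eta}.$$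
   Context: $\lVert\cdot\rVert$ and $\langle\cdot,\cdot\rangle$ are the Euclidean norm and inner product on $\mathbb{R}^d$. $f$ is globally $L$-Lipschitz if $|f(x)-f(y)|\le L\lVert x-y\rVert$ for all $x,y\in\mathbb{R}^d$ ($L$ need not be the minimal such constant). $\partial f(x)$ is the set of subgradients of $f$ at $x$, i.e. the vectors $g\in\mathbb{R}^d$ with $f(y)\ge f(x)+\langle g,y-x\rangle$ for every $y\in\mathbb{R}^d$. For a nonempty closed convex set $S\subseteq\mathbb{R}^d$, $\Pi_S$ is Euclidean projection onto $S$ and $\operatorname{dist}(x,S)=\inf_{z\in S}\lVert x-z\rVert$. *)

theory Defs
  imports "HOL-Analysis.Analysis"
begin

definition subdifferential :: "('a::real_inner \<Rightarrow> real) \<Rightarrow> 'a \<Rightarrow> 'a set" where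
  "subdifferential f x = {g. \<forall>y. f y \<ge> f x + g \<bullet> (y - x)}"

definition argmin_on :: "('a \<Rightarrow> 'b::linorder) \<Rightarrow> 'a set \<Rightarrow> 'a set" where
  "argmin_on f S = {x. is_arg_min f (\<lambda>z. z \<in> S) x}"

text \<open>The library's \<^const>\<open>Min\<close> is for finite sets only.  The value below is meaningful only
  if the minimum is attained, i.e. if the set of minimisers is nonempty.\<close>

definition min_on :: "('a \<Rightarrow> 'b::linorder) \<Rightarrow> 'a set \<Rightarrow> 'b" where
  "min_on f S = (LEAST v. v \<in> f ` S)"

text \<open>Euclidean projection onto \<open>S\<close> is the library's \<^const>\<open>closest_point\<close>, which is uniquely
  determined for nonempty closed convex \<open>S\<close>.  The sequences are indexed from 1: the values
  \<open>x 0\<close> and \<open>g 0\<close>, those of \<open>x\<close> beyond \<open>n\<close>, and those of \<open>g\<close> from \<open>n\<close> onwards are unconstrained.\<close>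

definition projected_subgradient_iterates ::
  "('a::euclidean_space \<Rightarrow> real) \<Rightarrow> 'a set \<Rightarrow> real \<Rightarrow> nat \<Rightarrow> (nat \<Rightarrow> 'a) \<Rightarrow> (nat \<Rightarrow> 'a) \<Rightarrow> bool" where
  "projected_subgradient_iterates f X \<eta> n g x \<longleftrightarrow>
     x 1 \<in> X \<and>
     (\<forall>k. 1 \<le> k \<and> k < n \<longrightarrow>
        g k \<in> subdifferential f (x k) \<and> x (k + 1) = closest_point X (x k - \<eta> *\<^sub>R g k))"

end

theory Submission
  imports Defs
begin

text \<open>
  Write \<open>u = \<eta> L\<^sup>2\<close>. One step raises \<open>f\<close> by at most
  \<open>u\<close>. The proof splits \<open>f (x n) - min f\<close> at the smallest value among
  \<open>f (x 1), \<dots>, f (x n)\<close>. The classical averaging argument bounds the best value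
  by \<open>u / 2\<close> plus the distance term. The dimension enters through the claim that the
  last value exceeds the best one by at most \<open>2 d u\<close>.

  Suppose that it exceeds it by more; let \<open>L > 0\<close>, as \<open>f\<close> is constant
  otherwise. Call \<open>p\<close> a record time if no value from time \<open>p\<close> to time
  \<open>n\<close> is below \<open>f (x p)\<close>. As the values rise by at most \<open>u\<close>
  per step, one can choose \<open>d + 1\<close> record times before \<open>n\<close> whose values
  lie below \<open>f (x n)\<close> and are at least \<open>u\<close> apart (each new record costs
  less than \<open>2 u\<close> of height; lemma \<open>separated_record_times\<close>). For two of
  them, \<open>p < q\<close>, no step from time \<open>q\<close> on increases the sum of the
  squared distances to \<open>x p\<close> and \<open>x q\<close>: the iterate is at least
  \<open>u\<close> higher than \<open>x p\<close> and not lower than \<open>x q\<close>, and this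
  pays for the two error terms \<open>\<eta>\<^sup>2 L\<^sup>2\<close>. At time \<open>q\<close>
  this sum is just the squared distance of \<open>x p\<close> and \<open>x q\<close>, so by the
  law of cosines \<open>x p\<close> and \<open>x q\<close> are seen from \<open>x n\<close> under
  an angle of at least 90 degrees (lemma \<open>records_seen_at_obtuse_angle\<close>). But
  \<open>x n\<close> is not in the convex hull of the \<open>d + 1\<close> record points, because
  \<open>f\<close> is convex and below \<open>f (x n)\<close> at each of them, and vectors with
  pairwise nonpositive inner products whose convex hull misses the origin are linearly independent
  (lemma \<open>independent_if_pairwise_obtuse\<close>). There are at most \<open>d\<close> such
  vectors.
\<close>

section \<open>Pairwise obtuse vectors\<close>

lemma zero_in_convex_hull_if_positive_combination:
  fixes A :: "'a::real_vector set"
  assumes "finite A" "A \<noteq> {}" "\<And>v. v \<in> A \<Longrightarrow> c v > 0" "(\<Sum>v\<in>A. c v *\<^sub>R v) = 0"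
  shows "0 \<in> convex hull A"
proof -
  define s where "s = sum c A"
  have "s > 0"
    unfolding s_def using assms by (intro sum_pos) auto
  have "(\<Sum>v\<in>A. (c v / s) *\<^sub>R v) \<in> convex hull A"
  proof (rule convex_sum)
    show "(\<Sum>v\<in>A. c v / s) = 1"
      using \<open>s > 0\<close> by (simp add: s_def flip: sum_divide_distrib)
    show "0 \<le> c v / s" if "v \<in> A" for v
      using assms(3)[OF that] \<open>s > 0\<close> by simp
  qed (use assms in \<open>auto intro: hull_inc\<close>)
  moreover have "(\<Sum>v\<in>A. (c v / s) *\<^sub>R v) = (1 / s) *\<^sub>R (\<Sum>v\<in>A. c v *\<^sub>R v)"
    by (simp add: scaleR_sum_right)
  ultimately show ?thesis
    using assms(4) by simp
qed

text \<open>In a linear relation, move the negative coefficients to the other side.  The common value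
  \<open>z\<close> of both sides has \<open>z \<bullet> z \<le> 0\<close>, because each side only meets vectors of the other.  So
  each side is a positive combination that vanishes, and one of them is not empty.\<close>

lemma independent_if_pairwise_obtuse:
  fixes W :: "'a::real_inner set"
  assumes "finite W"
    and obtuse: "\<And>v w. v \<in> W \<Longrightarrow> w \<in> W \<Longrightarrow> v \<noteq> w \<Longrightarrow> v \<bullet> w \<le> 0"
    and hull: "0 \<notin> convex hull W"
  shows "independent W"
proof
  assume "dependent W"
  then obtain c v\<^sub>0 where v\<^sub>0: "v\<^sub>0 \<in> W" "c v\<^sub>0 \<noteq> 0" and rel: "(\<Sum>v\<in>W. c v *\<^sub>R v) = 0"
    using dependent_finite[OF \<open>finite W\<close>] by auto
  define P where "P = {v \<in> W. c v > 0}"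
  define N where "N = {v \<in> W. c v < 0}"
  define z where "z = (\<Sum>v\<in>P. c v *\<^sub>R v)"
  have fin: "finite P" "finite N" and sub: "P \<subseteq> W" "N \<subseteq> W" and disj: "P \<inter> N = {}"
    using \<open>finite W\<close> by (auto simp: P_def N_def)
  have "(\<Sum>v\<in>W. c v *\<^sub>R v) = (\<Sum>v\<in>P \<union> N. c v *\<^sub>R v)"
    using \<open>finite W\<close> by (intro sum.mono_neutral_right) (auto simp: P_def N_def)
  also have "\<dots> = z + (\<Sum>v\<in>N. c v *\<^sub>R v)"
    unfolding z_def by (rule sum.union_disjoint[OF fin disj])
  finally have z_N: "z = (\<Sum>v\<in>N. (- c v) *\<^sub>R v)"
    using rel by (simp add: sum_negf eq_neg_iff_add_eq_0)
  have "z \<bullet> z = (\<Sum>v\<in>P. c v *\<^sub>R v) \<bullet> (\<Sum>w\<in>N. (- c w) *\<^sub>R w)"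
    using z_N z_def by simp
  also have "\<dots> = (\<Sum>w\<in>N. \<Sum>v\<in>P. (c v * - c w) * (v \<bullet> w))"
    by (simp add: inner_sum_left inner_sum_right sum_distrib_left sum_negf mult_ac)
  also have "\<dots> \<le> 0"
    using disj sub by (intro sum_nonpos mult_nonneg_nonpos obtuse) (auto simp: P_def N_def mult_le_0_iff)
  finally have "z = 0"
    by (metis inner_eq_zero_iff inner_ge_zero order_antisym)
  have empty: "A = {}" if "A \<subseteq> W" "\<And>v. v \<in> A \<Longrightarrow> b v > 0" "(\<Sum>v\<in>A. b v *\<^sub>R v) = 0" for A b
    using zero_in_convex_hull_if_positive_combination[of A b] that hull hull_mono[of A W convex]
      finite_subset[OF \<open>A \<subseteq> W\<close> \<open>finite W\<close>] by blast
  have "P = {}"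
    by (rule empty[OF sub(1), of c]) (use \<open>z = 0\<close> z_def in \<open>auto simp: P_def\<close>)
  moreover have "N = {}"
  proof (rule empty[OF sub(2)])
    show "(\<Sum>v\<in>N. (- c v) *\<^sub>R v) = 0"
      using \<open>z = 0\<close> z_N by (rule trans[OF sym, rotated])
  qed (simp add: N_def)
  ultimately show False
    using v\<^sub>0 unfolding P_def N_def by (metis (mono_tags, lifting) empty_iff linorder_neqE mem_Collect_eq)
qed

section \<open>Record times of a slowly rising sequence\<close>

text \<open>The first record is \<open>m\<close>, where \<open>F\<close> is smallest.  Let \<open>q\<close> be the last time at which the value
  is below \<open>F m + u\<close>.  The next record is the minimum after \<open>q\<close>; it is at least \<open>u\<close> higher than
  \<open>F m\<close>, and less than \<open>2 u\<close> higher because the step after \<open>q\<close> rises by at most \<open>u\<close>.\<close>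

lemma separated_record_times:
  fixes F :: "nat \<Rightarrow> real"
  assumes "u > 0"
    and rise: "\<And>k. m \<le> k \<Longrightarrow> k < n \<Longrightarrow> F (Suc k) \<le> F k + u"
    and "m \<le> n" "\<And>k. k \<in> {m..n} \<Longrightarrow> F m \<le> F k"
    and "F m + 2 * real N * u < F n"
  shows "\<exists>P \<subseteq> {m..<n}. card P = Suc N \<and> (\<forall>p\<in>P. F p < F n \<and> (\<forall>k\<in>{p..n}. F p \<le> F k))
    \<and> (\<forall>p\<in>P. \<forall>q\<in>P. p < q \<longrightarrow> F p + u \<le> F q)"
  using assms(2-)
proof (induction N arbitrary: m)
  case 0
  then have "m < n"
    by (cases "m = n") auto
  with 0 show ?case
    by (intro exI[of _ "{m}"]) auto
next
  case (Suc N)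
  define A where "A = {k \<in> {m..n}. F k < F m + u}"
  define q where "q = Max A"
  have above: "F m + 2 * u + 2 * real N * u < F n"
    using Suc.prems(4) by (simp add: algebra_simps)
  have "finite A" "m \<in> A"
    using \<open>u > 0\<close> Suc.prems(2) by (auto simp: A_def)
  then have "q \<in> A" and q_max: "\<And>k. k \<in> A \<Longrightarrow> k \<le> q"
    unfolding q_def by (auto intro: Max_in)
  have "2 * real N * u \<ge> 0"
    using \<open>u > 0\<close> by simp
  then have "F m + u \<le> F n"
    using above \<open>u > 0\<close> by linarith
  then have "n \<notin> A"
    by (simp add: A_def)
  with \<open>q \<in> A\<close> have q: "m \<le> q" "q < n" "F q < F m + u"
    by (auto simp: A_def le_less)
  have after_q: "F m + u \<le> F k" if "q < k" "k \<le> n" for k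
  proof -
    have "k \<notin> A"
      using q_max[of k] that by auto
    then show ?thesis
      using that q by (auto simp: A_def)
  qed
  have "finite {Suc q..n}" "{Suc q..n} \<noteq> {}"
    using q by auto
  then obtain m' where m': "m' \<in> {Suc q..n}" "\<And>k. k \<in> {Suc q..n} \<Longrightarrow> F m' \<le> F k"
    using ex_is_arg_min_if_finite[of "{Suc q..n}" F] unfolding is_arg_min_linorder by blast
  have "F m' \<le> F (Suc q)"
    using m'(2)[of "Suc q"] q by simp
  also have "\<dots> < F m + 2 * u"
    using Suc.prems(1)[of q] q by simp
  finally have m'_below: "F m' + 2 * real N * u < F n"
    using above by simp
  have "m < m'" "q < m'" "m' \<le> n"
    using m'(1) q by auto
  have "\<exists>P \<subseteq> {m'..<n}. card P = Suc N \<and> (\<forall>p\<in>P. F p < F n \<and> (\<forall>k\<in>{p..n}. F p \<le> F k))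
    \<and> (\<forall>p\<in>P. \<forall>q\<in>P. p < q \<longrightarrow> F p + u \<le> F q)"
  proof (rule Suc.IH)
    show "F (Suc k) \<le> F k + u" if "m' \<le> k" "k < n" for k
      using Suc.prems(1) that \<open>m < m'\<close> by simp
    show "F m' \<le> F k" if "k \<in> {m'..n}" for k
      using m'(2) that \<open>q < m'\<close> by simp
  qed (use \<open>m' \<le> n\<close> m'_below in auto)
  then obtain P where P: "P \<subseteq> {m'..<n}" "card P = Suc N"
    "\<forall>p\<in>P. F p < F n \<and> (\<forall>k\<in>{p..n}. F p \<le> F k)"
    "\<forall>p\<in>P. \<forall>q\<in>P. p < q \<longrightarrow> F p + u \<le> F q"
    by blast
  have later: "m < p \<and> F m + u \<le> F p" if "p \<in> P" for p
  proof -
    have "m' \<le> p" "p < n"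
      using P(1) that by auto
    then show ?thesis
      using \<open>m < m'\<close> \<open>q < m'\<close> after_q[of p] by simp
  qed
  have "m \<notin> P" "finite P"
    using later P(1) finite_subset by auto
  show ?case
  proof (intro exI conjI)
    show "insert m P \<subseteq> {m..<n}"
      using P(1) \<open>m < m'\<close> \<open>m' \<le> n\<close> by (auto simp: subset_iff)
    show "card (insert m P) = Suc (Suc N)"
      using \<open>m \<notin> P\<close> \<open>finite P\<close> P(2) by simp
    show "\<forall>p\<in>insert m P. F p < F n \<and> (\<forall>k\<in>{p..n}. F p \<le> F k)"
      using P(3) Suc.prems(3) \<open>F m + u \<le> F n\<close> \<open>u > 0\<close> by auto
    show "\<forall>p\<in>insert m P. \<forall>q\<in>insert m P. p < q \<longrightarrow> F p + u \<le> F q"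
      using P(4) later by (auto dest: less_asym)
  qed
qed

section \<open>Projected subgradient steps\<close>

lemma norm_subgradient_le:
  fixes f :: "'a::real_inner \<Rightarrow> real"
  assumes "L-lipschitz_on UNIV f" "g \<in> subdifferential f x"
  shows "norm g \<le> L"
proof -
  have "g \<bullet> g \<le> f (x + g) - f x"
    using assms(2) by (auto simp: subdifferential_def dest: spec[of _ "x + g"])
  also have "\<dots> \<le> L * norm g"
    using lipschitz_onD[OF assms(1), of "x + g" x] by (simp add: dist_norm)
  finally have "norm g * norm g \<le> L * norm g"
    by (simp flip: power2_norm_eq_inner power2_eq_square)
  then show ?thesis
    using lipschitz_on_nonneg[OF assms(1)] by (cases "g = 0") auto
qed

locale projected_subgradient_run =
  fixes f :: "'a::euclidean_space \<Rightarrow> real" and X :: "'a set"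
    and L \<eta> :: real and n :: nat and g x :: "nat \<Rightarrow> 'a"
  assumes convex_f: "convex_on UNIV f"
    and lipschitz: "L-lipschitz_on UNIV f"
    and X: "closed X" "convex X"
    and n: "n \<ge> 1" and \<eta>: "\<eta> > 0"
    and iterates: "projected_subgradient_iterates f X \<eta> n g x"
begin

lemma subgradient: "1 \<le> k \<Longrightarrow> k < n \<Longrightarrow> g k \<in> subdifferential f (x k)"
  and step: "1 \<le> k \<Longrightarrow> k < n \<Longrightarrow> x (Suc k) = closest_point X (x k - \<eta> *\<^sub>R g k)"
  and x1_in_X: "x 1 \<in> X"
  using iterates by (auto simp: projected_subgradient_iterates_def)

lemma x_in_X:
  assumes "1 \<le> k" "k \<le> n"
  shows "x k \<in> X"
proof (cases "k = 1")
  case False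
  then obtain j where "k = Suc j" "1 \<le> j" "j < n"
    using assms by (cases k) auto
  then show ?thesis
    using step closest_point_in_set[OF X(1)] x1_in_X by auto
qed (simp add: x1_in_X[simplified])

text \<open>Projecting does not increase the distance to a point of \<open>X\<close>, since that point is its own
  projection.\<close>

lemma step_dist_le:
  assumes "1 \<le> k" "k < n" "z \<in> X"
  shows "norm (x (Suc k) - z) \<le> norm (x k - \<eta> *\<^sub>R g k - z)"
proof -
  have "X \<noteq> {}" "closest_point X z = z"
    using assms(3) closest_point_self by auto
  then show ?thesis
    using closest_point_lipschitz[OF X(2,1), of "x k - \<eta> *\<^sub>R g k" z] step[OF assms(1,2)]
    by (simp add: dist_norm)
qed

lemma step_dist_square_le:
  assumes "1 \<le> k" "k < n" "z \<in> X"
  shows "(norm (x (Suc k) - z))\<^sup>2 \<le> (norm (x k - z))\<^sup>2 - 2 * \<eta> * (f (x k) - f z) + \<eta>\<^sup>2 * L\<^sup>2"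
proof -
  have "(norm (x (Suc k) - z))\<^sup>2 \<le> (norm (x k - \<eta> *\<^sub>R g k - z))\<^sup>2"
    using step_dist_le[OF assms] by (simp add: power_mono)
  also have "\<dots> = (norm (x k - z))\<^sup>2 + 2 * \<eta> * (g k \<bullet> (z - x k)) + \<eta>\<^sup>2 * (norm (g k))\<^sup>2"
    unfolding power2_norm_eq_inner
    by (simp add: inner_simps inner_commute power2_eq_square algebra_simps)
  also have "\<dots> \<le> (norm (x k - z))\<^sup>2 + 2 * \<eta> * (f z - f (x k)) + \<eta>\<^sup>2 * L\<^sup>2"
  proof (intro add_mono mult_left_mono order_refl)
    show "g k \<bullet> (z - x k) \<le> f z - f (x k)"
      using subgradient[OF assms(1,2)] by (auto simp: subdifferential_def algebra_simps)
    show "(norm (g k))\<^sup>2 \<le> L\<^sup>2"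
      using norm_subgradient_le[OF lipschitz subgradient[OF assms(1,2)]] by (simp add: power_mono)
  qed (use \<eta> in auto)
  finally show ?thesis
    by (simp add: algebra_simps)
qed

lemma step_rise_le:
  assumes "1 \<le> k" "k < n"
  shows "f (x (Suc k)) \<le> f (x k) + \<eta> * L\<^sup>2"
proof -
  have L: "L \<ge> 0"
    by (rule lipschitz_on_nonneg[OF lipschitz])
  have "f (x (Suc k)) - f (x k) \<le> L * norm (x (Suc k) - x k)"
    using lipschitz_onD[OF lipschitz, of "x (Suc k)" "x k"] by (simp add: dist_norm)
  also have "\<dots> \<le> L * (\<eta> * L)"
  proof (intro mult_left_mono L)
    have "norm (x (Suc k) - x k) \<le> \<eta> * norm (g k)"
      using step_dist_le[OF assms x_in_X[of k]] assms \<eta> by simp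
    also have "\<dots> \<le> \<eta> * L"
      using norm_subgradient_le[OF lipschitz subgradient[OF assms]] \<eta> by simp
    finally show "norm (x (Suc k) - x k) \<le> \<eta> * L" .
  qed
  finally show ?thesis
    by (simp add: power2_eq_square algebra_simps)
qed

section \<open>The last value against the best value\<close>

text \<open>The distance to \<open>x q\<close> alone can grow, being zero at time \<open>q\<close>.  The height above \<open>x p\<close> makes
  up for this in the sum \<open>\<phi>\<close> of the squared distances, and \<open>\<phi> n \<le> \<phi> q = \<parallel>x q - x p\<parallel>\<^sup>2\<close> is the
  assertion on the angle.\<close>

lemma records_seen_at_obtuse_angle:
  assumes "1 \<le> p" "p < q" "q \<le> n"
    and gap: "f (x p) + \<eta> * L\<^sup>2 \<le> f (x q)"
    and is_record: "\<And>k. k \<in> {q..n} \<Longrightarrow> f (x q) \<le> f (x k)"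
  shows "(x p - x n) \<bullet> (x q - x n) \<le> 0"
proof -
  define \<phi> where "\<phi> k = (norm (x k - x p))\<^sup>2 + (norm (x k - x q))\<^sup>2" for k
  have in_X: "x p \<in> X" "x q \<in> X"
    using assms x_in_X by auto
  have descent: "\<phi> (Suc k) \<le> \<phi> k" if "q \<le> k" "k < n" for k
  proof -
    have "\<eta> * L\<^sup>2 \<le> (f (x k) - f (x p)) + (f (x k) - f (x q))"
      using gap is_record[of k] that by simp
    then have "\<eta> * (\<eta> * L\<^sup>2) \<le> \<eta> * ((f (x k) - f (x p)) + (f (x k) - f (x q)))"
      using \<eta> by (intro mult_left_mono) auto
    then show ?thesis
      using step_dist_square_le[of k, OF _ _ in_X(1)] step_dist_square_le[of k, OF _ _ in_X(2)]
        that assms(1,2)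
      by (simp add: \<phi>_def power2_eq_square algebra_simps)
  qed
  have "\<phi> n \<le> \<phi> q"
    using \<open>q \<le> n\<close> by (induction rule: dec_induct[where i = q]) (auto intro: order_trans[OF descent])
  then have "(norm (x n - x p))\<^sup>2 + (norm (x n - x q))\<^sup>2 \<le> (norm (x q - x p))\<^sup>2"
    by (simp add: \<phi>_def)
  then show ?thesis
    by (simp add: power2_norm_eq_inner inner_simps inner_commute algebra_simps)
qed

text \<open>Otherwise there are \<open>d + 1\<close> separated records.  Seen from \<open>x n\<close>, they are pairwise obtuse and
  lie in the convex set on which \<open>f\<close> is below \<open>f (x n)\<close>, so they are independent.\<close>

lemma last_value_le_best_value:
  assumes "L > 0" "m \<in> {1..n}" "\<And>k. k \<in> {1..n} \<Longrightarrow> f (x m) \<le> f (x k)"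
  shows "f (x n) \<le> f (x m) + 2 * real DIM('a) * (\<eta> * L\<^sup>2)"
proof (rule ccontr)
  define u where "u = \<eta> * L\<^sup>2"
  have "u > 0"
    using \<open>L > 0\<close> \<eta> by (simp add: u_def)
  assume "\<not> ?thesis"
  then obtain P where P: "P \<subseteq> {m..<n}" "card P = Suc DIM('a)"
    and lower: "\<And>p. p \<in> P \<Longrightarrow> f (x p) < f (x n)"
    and is_record: "\<And>p k. p \<in> P \<Longrightarrow> k \<in> {p..n} \<Longrightarrow> f (x p) \<le> f (x k)"
    and gap: "\<And>p q. p \<in> P \<Longrightarrow> q \<in> P \<Longrightarrow> p < q \<Longrightarrow> f (x p) + u \<le> f (x q)"
    using separated_record_times[of u m n "\<lambda>k. f (x k)" "DIM('a)"] \<open>u > 0\<close> assms(2,3) step_rise_le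
    by (force simp: u_def not_le)
  define w where "w p = x p - x n" for p
  have w_neq: "w p \<noteq> w q" if "p \<in> P" "q \<in> P" "p \<noteq> q" for p q
    using gap[of p q] gap[of q p] that \<open>u > 0\<close> by (cases p q rule: linorder_cases) (auto simp: w_def)
  then have "inj_on w P"
    by (auto intro: inj_onI)
  have ordered: "w p \<bullet> w q \<le> 0" if "p \<in> P" "q \<in> P" "p < q" for p q
    unfolding w_def using that P(1) assms(2) gap[of p q] is_record[of q]
    by (intro records_seen_at_obtuse_angle) (force simp: u_def subset_iff)+
  have obtuse: "w p \<bullet> w q \<le> 0" if "p \<in> P" "q \<in> P" "p \<noteq> q" for p q
    using ordered[of p q] ordered[of q p] that by (cases p q rule: linorder_cases) (auto simp: inner_commute)
  have "convex {v. f (x n + v) < f (x n)}"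
  proof (rule convexI, clarsimp)
    fix v v' :: 'a and a b :: real
    assume v: "f (x n + v) < f (x n)" "f (x n + v') < f (x n)" and ab: "0 \<le> a" "0 \<le> b" "a + b = 1"
    have a: "a = 1 - b"
      using ab(3) by simp
    have "x n + (a *\<^sub>R v + b *\<^sub>R v') = a *\<^sub>R (x n + v) + b *\<^sub>R (x n + v')"
      unfolding a by (simp add: algebra_simps)
    also have "f \<dots> \<le> a * f (x n + v) + b * f (x n + v')"
      using convex_f ab by (auto simp: convex_on_def)
    also have "\<dots> < f (x n)"
      using convex_bound_lt[OF v ab] .
    finally show "f (x n + (a *\<^sub>R v + b *\<^sub>R v')) < f (x n)" .
  qed
  then have "convex hull (w ` P) \<subseteq> {v. f (x n + v) < f (x n)}"
    using lower by (intro hull_minimal) (auto simp: w_def)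
  then have "0 \<notin> convex hull (w ` P)"
    by auto
  moreover have "finite P"
    using P(1) finite_subset by blast
  ultimately have "independent (w ` P)"
    using obtuse by (intro independent_if_pairwise_obtuse) auto
  then have "card (w ` P) \<le> DIM('a)"
    using independent_bound by blast
  then show False
    using P(2) card_image[OF \<open>inj_on w P\<close>] by simp
qed

section \<open>The best value against the minimum\<close>

text \<open>The step inequality is summed over the steps up to \<open>n - 1\<close>.  The missing summand for \<open>x n\<close>,
  at which no subgradient is given, comes from the Lipschitz bound
  \<open>f (x n) - f z \<le> L \<parallel>x n - z\<parallel>\<close> and the inequality of arithmetic and geometric means, which
  use up the squared distance of \<open>x n\<close> and \<open>z\<close> left over by telescoping.\<close>

lemma sum_of_values_le:
  assumes "z \<in> X"
  shows "2 * \<eta> * (\<Sum>k=1..n. f (x k) - f z) \<le> (norm (x 1 - z))\<^sup>2 + real n * (\<eta>\<^sup>2 * L\<^sup>2)"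
proof -
  have telescope: "2 * \<eta> * (\<Sum>k=1..<m. f (x k) - f z) + (norm (x m - z))\<^sup>2
      \<le> (norm (x 1 - z))\<^sup>2 + real (m - 1) * (\<eta>\<^sup>2 * L\<^sup>2)" if "1 \<le> m" "m \<le> n" for m
    using that
  proof (induction m rule: dec_induct)
    case (step k)
    have count: "real (Suc k - 1) * (\<eta>\<^sup>2 * L\<^sup>2) = real (k - 1) * (\<eta>\<^sup>2 * L\<^sup>2) + \<eta>\<^sup>2 * L\<^sup>2"
      using step.hyps by (simp add: algebra_simps of_nat_diff)
    have last_summand: "2 * \<eta> * (\<Sum>k=1..<Suc k. f (x k) - f z)
      = 2 * \<eta> * (\<Sum>k=1..<k. f (x k) - f z) + 2 * \<eta> * (f (x k) - f z)"
      using step.hyps by (simp add: distrib_left)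
    have "2 * \<eta> * (\<Sum>k=1..<k. f (x k) - f z) + (norm (x k - z))\<^sup>2
      \<le> (norm (x 1 - z))\<^sup>2 + real (k - 1) * (\<eta>\<^sup>2 * L\<^sup>2)"
      using step by simp
    then show ?case
      using step_dist_square_le[OF _ _ assms, of k] step.hyps step.prems
      unfolding count last_summand by simp
  qed simp
  have "f (x n) - f z \<le> L * norm (x n - z)"
    using lipschitz_onD[OF lipschitz, of "x n" z] by (simp add: dist_norm)
  then have "2 * \<eta> * (f (x n) - f z) \<le> 2 * \<eta> * (L * norm (x n - z))"
    using \<eta> by (intro mult_left_mono) auto
  also have "\<dots> \<le> \<eta>\<^sup>2 * L\<^sup>2 + (norm (x n - z))\<^sup>2"
    using sum_squares_bound[of "\<eta> * L" "norm (x n - z)"] by (simp add: power_mult_distrib mult_ac)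
  finally have last: "2 * \<eta> * (f (x n) - f z) \<le> \<eta>\<^sup>2 * L\<^sup>2 + (norm (x n - z))\<^sup>2" .
  have "(\<Sum>k=1..n. f (x k) - f z) = (\<Sum>k=1..<n. f (x k) - f z) + (f (x n) - f z)"
    using n by (simp add: sum.last_plus)
  moreover have "real n = real (n - 1) + 1"
    using n by simp
  ultimately show ?thesis
    using telescope[of n] last n by (simp only: distrib_left distrib_right) simp
qed

lemma best_value_le:
  assumes "\<And>k. k \<in> {1..n} \<Longrightarrow> v \<le> f (x k)" "z \<in> X"
  shows "v - f z \<le> \<eta> * L\<^sup>2 / 2 + (norm (x 1 - z))\<^sup>2 / (2 * real n * \<eta>)"
proof -
  have "real n * (v - f z) = (\<Sum>k=1..n. v - f z)"
    by simp
  also have "\<dots> \<le> (\<Sum>k=1..n. f (x k) - f z)"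
    using assms(1) by (intro sum_mono) simp
  finally have "2 * \<eta> * (real n * (v - f z)) \<le> 2 * \<eta> * (\<Sum>k=1..n. f (x k) - f z)"
    using \<eta> by simp
  also have "\<dots> \<le> (norm (x 1 - z))\<^sup>2 + real n * (\<eta>\<^sup>2 * L\<^sup>2)"
    by (rule sum_of_values_le[OF assms(2)])
  finally show ?thesis
    using n \<eta> by (simp add: field_simps power2_eq_square)
qed

text \<open>For \<open>L = 0\<close> the unit of height \<open>\<eta> L\<^sup>2\<close> vanishes, so it cannot separate records, but then \<open>f\<close>
  is constant.\<close>

lemma last_value_le:
  assumes "z \<in> X"
  shows "f (x n) - f z
    \<le> (2 * real DIM('a) + 1 / 2) * \<eta> * L\<^sup>2 + (norm (x 1 - z))\<^sup>2 / (2 * real n * \<eta>)"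
proof (cases "L = 0")
  case True
  then have "f (x n) = f z"
    using lipschitz_onD[OF lipschitz, of "x n" z] by simp
  then show ?thesis
    using True n \<eta> by simp
next
  case False
  then have "L > 0"
    using lipschitz_on_nonneg[OF lipschitz] by simp
  obtain m where m: "m \<in> {1..n}" "\<And>k. k \<in> {1..n} \<Longrightarrow> f (x m) \<le> f (x k)"
    using ex_is_arg_min_if_finite[of "{1..n}" "\<lambda>k. f (x k)"] n by (force simp: is_arg_min_linorder)
  have "f (x n) - f z \<le> 2 * real DIM('a) * (\<eta> * L\<^sup>2) + (f (x m) - f z)"
    using last_value_le_best_value[OF \<open>L > 0\<close> m] by simp
  also have "f (x m) - f z \<le> \<eta> * L\<^sup>2 / 2 + (norm (x 1 - z))\<^sup>2 / (2 * real n * \<eta>)"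
    using m(2) assms by (rule best_value_le)
  finally show ?thesis
    by (simp add: algebra_simps)
qed

end

section \<open>The last-iterate bound\<close>

lemma min_on_eq:
  assumes "z \<in> argmin_on f S"
  shows "min_on f S = f z"
  unfolding min_on_def using assms
  by (intro Least_equality) (auto simp: argmin_on_def is_arg_min_linorder)

lemma closed_argmin_on:
  fixes f :: "'a::topological_space \<Rightarrow> real"
  assumes "continuous_on UNIV f" "closed S"
  shows "closed (argmin_on f S)"
proof -
  have "argmin_on f S = S \<inter> (\<Inter>y\<in>S. {z. f z \<le> f y})"
    by (auto simp: argmin_on_def is_arg_min_linorder)
  then show ?thesis
    using assms by (auto intro!: closed_Int closed_INT closed_Collect_le)
qed

theorem theorem2:
  fixes f :: "real ^ 'd \<Rightarrow> real" and X :: "(real ^ 'd) set"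
    and L \<eta> :: real and n :: nat and g x :: "nat \<Rightarrow> real ^ 'd"
  assumes "L \<ge> 0"
    and "convex_on UNIV f"
    and "L-lipschitz_on UNIV f"
    and "X \<noteq> {}" and "closed X" and "convex X"
    and "argmin_on f X \<noteq> {}"
    and "n \<ge> 1" and "\<eta> > 0"
    and "projected_subgradient_iterates f X \<eta> n g x"
  shows "f (x n) - min_on f X
    \<le> (2 * real CARD('d) + 1 / 2) * \<eta> * L\<^sup>2
      + (infdist (x 1) (argmin_on f X))\<^sup>2 / (2 * real n * \<eta>)"
proof -
  interpret projected_subgradient_run f X L \<eta> n g x
    using assms by unfold_locales
  have "closed (argmin_on f X)"
    using closed_argmin_on lipschitz_on_continuous_on assms by blast
  then obtain z where z: "z \<in> argmin_on f X" "infdist (x 1) (argmin_on f X) = dist (x 1) z"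
    using infdist_attains_inf assms by blast
  then have "z \<in> X"
    by (auto simp: argmin_on_def is_arg_min_linorder)
  then show ?thesis
    using last_value_le[of z] min_on_eq[OF z(1)] z(2) by (simp add: dist_norm)
qed

end
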